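(* Let $\mathcal{M}_1 = (V, \mathcal{I}_1)$ and $\mathcal{M}_2 = (V, \mathcal{I}_2)$ be two matroids on the same ground set $V$ with $|V| = n$, accessible only through independence oracles, and let $r$ be the maximum cardinality of a common independent set. For any $\varepsilon > 0$, there is a deterministic algorithm that finds a common independent set $S \in \mathcal{I}_1 \cap \mathcal{I}_2$ with $|S| \geq (2/3 - \varepsilon) r$, using $O(\frac{n}{\varepsilon} + r \log r)$ independence oracle queries.
   Context: A matroid $\mathcal{M} = (V,\mathcal{I})$ is given by a finite ground set $V$ and a nonempty family $\mathcal{I}\subseteq 2^V$ of independent sets satisfying the downward closure and augmentation properties. A common independent set of $\mathcal{M}_1,\mathcal{M}_2$ is a set in $\mathcal{I}_1 \cap \mathcal{I}_2$. An independence oracle for $\mathcal{M}_i$ takes as input a subset $S \subseteq V$ and answers whether $S \in \mathcal{I}_i$; each such call counts as one query. *)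

theory Defs
  imports Complex_Main
begin

locale matroid =
  fixes V :: "'a set" and \<I> :: "'a set set"
  assumes finite_ground: "finite V"
    and indep_subset: "\<And>A. A \<in> \<I> \<Longrightarrow> A \<subseteq> V"
    and indep_nonempty: "\<I> \<noteq> {}"
    and downward_closed: "\<And>A B. B \<in> \<I> \<Longrightarrow> A \<subseteq> B \<Longrightarrow> A \<in> \<I>"
    and augmentation: "\<And>A B. A \<in> \<I> \<Longrightarrow> B \<in> \<I> \<Longrightarrow> card A < card B
                          \<Longrightarrow> \<exists>x\<in>B - A. insert x A \<in> \<I>"

definition max_common_indep :: "'a set set \<Rightarrow> 'a set set \<Rightarrow> nat" where
  "max_common_indep \<I>\<^sub>1 \<I>\<^sub>2 = Max (card ` (\<I>\<^sub>1 \<inter> \<I>\<^sub>2))"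

datatype side = First | Second

text \<open>
  Deterministic adaptive algorithms in the oracle model: decision trees whose inner nodes ask one of
  the two independence oracles about a set and branch on the answer. A tree does not contain the
  matroids, so they influence a run only through the answers. The datatype is inductive, so every
  run terminates.
\<close>

datatype 'a oracle_alg =
    Output "'a set"
  | Query side "'a set" "bool \<Rightarrow> 'a oracle_alg"

fun indep_oracle :: "'a set set \<Rightarrow> 'a set set \<Rightarrow> side \<Rightarrow> 'a set \<Rightarrow> bool" where
  "indep_oracle \<I>\<^sub>1 \<I>\<^sub>2 First S \<longleftrightarrow> S \<in> \<I>\<^sub>1"
| "indep_oracle \<I>\<^sub>1 \<I>\<^sub>2 Second S \<longleftrightarrow> S \<in> \<I>\<^sub>2"

primrec result :: "(side \<Rightarrow> 'a set \<Rightarrow> bool) \<Rightarrow> 'a oracle_alg \<Rightarrow> 'a set" where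
  "result orc (Output S) = S"
| "result orc (Query i S k) = result orc (k (orc i S))"

text \<open>Number of oracle calls on the run determined by \<open>orc\<close>; repeated calls count repeatedly.\<close>

primrec num_queries :: "(side \<Rightarrow> 'a set \<Rightarrow> bool) \<Rightarrow> 'a oracle_alg \<Rightarrow> nat" where
  "num_queries orc (Output S) = 0"
| "num_queries orc (Query i S k) = Suc (num_queries orc (k (orc i S)))"

primrec queries_within :: "'a set \<Rightarrow> 'a oracle_alg \<Rightarrow> bool" where
  "queries_within V (Output S) \<longleftrightarrow> True"
| "queries_within V (Query i S k) \<longleftrightarrow> S \<subseteq> V \<and> (\<forall>b. queries_within V (k b))"

end

theory Submission imports Defs begin

text \<open>
  Start from a greedy maximal common independent set \<open>S\<close> and augment it along many disjoint paths of
  length three at once. The set \<open>S\<close> is split into removed elements \<open>R\<close>, fresh elements \<open>F\<close> and the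
  remaining ones, which are tentatively exchanged for \<open>B\<^sub>1\<close> in the second matroid and for \<open>B\<^sub>2\<close> in the
  first one; both \<open>R \<union> F \<union> B\<^sub>1\<close> and \<open>R \<union> F \<union> B\<^sub>2\<close> are kept at size \<open>card S\<close>, so
  \<open>R \<union> F \<union> B\<^sub>1 \<union> B\<^sub>2\<close> is a common independent set of size \<open>card S + card B\<^sub>2\<close>. One round
  extends \<open>B\<^sub>1\<close>, shrinks \<open>F\<close> accordingly, extends \<open>B\<^sub>2\<close>, and moves to \<open>R\<close> the elements of \<open>S\<close>
  that \<open>B\<^sub>2\<close> failed to match. It consists of five greedy scans. With \<open>C\<close> the extended \<open>B\<^sub>1\<close>, every
  element is spanned by \<open>S \<union> C\<close> in the first or by \<open>R \<union> C\<close> in the second matroid, and also by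
  \<open>F \<union> B\<^sub>2\<close> in the first or by \<open>S \<union> B\<^sub>2\<close> in the second. Adding the two rank bounds shows that
  \<open>2 r - 3 (card S + card B\<^sub>2)\<close> is at most the growth of \<open>R\<close> in this round. As \<open>R \<subseteq> S\<close>, the total
  growth over \<open>k\<close> rounds is at most \<open>r\<close>, so \<open>k \<ge> 1 / \<epsilon>\<close> rounds suffice.
\<close>

section \<open>Rank bounds and exchange in one matroid\<close>

context matroid
begin

lemma indep_empty: "{} \<in> \<I>"
  using indep_nonempty downward_closed by blast

lemma indep_finite: "A \<in> \<I> \<Longrightarrow> finite A"
  using indep_subset finite_ground finite_subset by blast

lemma indep_extend:
  assumes "X \<in> \<I>" "Y \<in> \<I>" "card X \<le> card Y"
  shows "\<exists>W\<in>\<I>. X \<subseteq> W \<and> W \<subseteq> X \<union> Y \<and> card W = card Y"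
  using assms
proof (induction "card Y - card X" arbitrary: X)
  case 0
  then show ?case by auto
next
  case (Suc m)
  have "card X < card Y" using Suc.hyps(2) by linarith
  then obtain x where x: "x \<in> Y - X" "insert x X \<in> \<I>"
    using augmentation[OF Suc.prems(1,2)] by blast
  have "card (insert x X) = Suc (card X)"
    using x indep_finite[OF Suc.prems(1)] by simp
  then obtain W where "W \<in> \<I>" "insert x X \<subseteq> W" "W \<subseteq> insert x X \<union> Y" "card W = card Y"
    using Suc.hyps(1)[of "insert x X"] Suc.hyps(2) x Suc.prems by force
  then show ?case using x by blast
qed

text \<open>This is the usual closure only when \<open>X\<close> is independent.\<close>

definition span :: "'a set \<Rightarrow> 'a set" where
  "span X = {x \<in> V. x \<in> X \<or> insert x X \<notin> \<I>}"

text \<open>If \<open>T\<close> were larger, augmentation would add to \<open>X\<close> an element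
  of \<open>T\<close> lying outside \<open>span X\<close>.\<close>

lemma card_le_if_spanned:
  assumes "T \<in> \<I>" "X \<in> \<I>" "T \<subseteq> span X"
  shows "card T \<le> card X"
  using augmentation[OF assms(2,1)] assms(3) unfolding span_def by force

lemma card_Int_span_le:
  assumes "T \<in> \<I>" "X \<in> \<I>"
  shows "card (T \<inter> span X) \<le> card X"
  using card_le_if_spanned downward_closed assms by (meson inf_le1 inf_le2)

text \<open>Pad \<open>X\<close> from \<open>R \<union> Y\<close> to an independent \<open>W\<close>
  of size \<open>card (R \<union> Y)\<close>. The part of \<open>W\<close> outside \<open>R\<close>
  is spanned by \<open>Y\<close>, so it has at most \<open>card Y\<close> elements, which forces
  \<open>W\<close> to contain all of \<open>R\<close>.\<close>

lemma indep_Un_if_spanned: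
  assumes X: "X \<in> \<I>" "X \<subseteq> span Y" and RY: "R \<union> Y \<in> \<I>" and disj: "R \<inter> Y = {}"
  shows "R \<union> X \<in> \<I>"
proof -
  have Y: "Y \<in> \<I>" using RY downward_closed by blast
  have fin: "finite R" "finite Y" using indep_finite[OF RY] by auto
  have card_RY: "card (R \<union> Y) = card R + card Y" using fin disj by (simp add: card_Un_disjoint)
  have "card X \<le> card (R \<union> Y)"
    using card_le_if_spanned[OF X(1) Y X(2)] card_RY by simp
  then obtain W where W: "W \<in> \<I>" "X \<subseteq> W" "W \<subseteq> X \<union> (R \<union> Y)" "card W = card (R \<union> Y)"
    using indep_extend[OF X(1) RY] by blast
  have finW: "finite W" using W indep_finite by blast
  have "Y \<subseteq> span Y" using indep_subset[OF Y] unfolding span_def by blast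
  hence "W - R \<subseteq> span Y" using W X by blast
  hence "card (W - R) \<le> card Y"
    using card_le_if_spanned[of "W - R" Y] Y W downward_closed by blast
  moreover have "card W = card (W - R) + card (W \<inter> R)"
    using finW by (metis Diff_Int2 Diff_Int_distrib2 Int_commute add.commute card_Int_Diff)
  ultimately have "card R \<le> card (W \<inter> R)" using W card_RY by simp
  hence "R \<subseteq> W" using fin by (metis card_seteq inf.absorb_iff2 inf_le2)
  then show ?thesis using W downward_closed by (metis Un_subset_iff)
qed

end

section \<open>Greedy scans as decision trees\<close>

text \<open>There is no early exit after a negative answer, so a candidate always costs
  \<open>length qs\<close> queries. Continuations stand in for sequential composition of decision
  trees.\<close>

primrec ask_all :: "(side \<times> 'a set) list \<Rightarrow> (bool \<Rightarrow> 'a oracle_alg) \<Rightarrow> 'a oracle_alg" where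
  "ask_all [] k = k True"
| "ask_all (q # qs) k = Query (fst q) (snd q) (\<lambda>b. ask_all qs (\<lambda>c. k (b \<and> c)))"

primrec scan :: "(side \<times> 'a set) list \<Rightarrow> 'a list \<Rightarrow> 'a set \<Rightarrow> ('a set \<Rightarrow> 'a oracle_alg)
    \<Rightarrow> 'a oracle_alg" where
  "scan qs [] B k = k B"
| "scan qs (x # xs) B k =
    ask_all (map (\<lambda>q. (fst q, snd q \<union> insert x B)) qs)
      (\<lambda>b. scan qs xs (if b then insert x B else B) k)"

definition passes :: "(side \<Rightarrow> 'a set \<Rightarrow> bool) \<Rightarrow> (side \<times> 'a set) list \<Rightarrow> 'a set \<Rightarrow> bool" where
  "passes orc qs B \<longleftrightarrow> (\<forall>q\<in>set qs. orc (fst q) (snd q \<union> B))"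

lemma result_ask_all:
  "result orc (ask_all qs k) = result orc (k (\<forall>q\<in>set qs. orc (fst q) (snd q)))"
  by (induction qs arbitrary: k) (auto intro: arg_cong[where f = "\<lambda>b. result orc (k b)" for k])

lemma num_queries_ask_all:
  "num_queries orc (ask_all qs k) =
    length qs + num_queries orc (k (\<forall>q\<in>set qs. orc (fst q) (snd q)))"
  by (induction qs arbitrary: k) (auto intro: arg_cong[where f = "\<lambda>b. num_queries orc (k b)" for k])

lemma queries_within_ask_all:
  "(\<And>q. q \<in> set qs \<Longrightarrow> snd q \<subseteq> V) \<Longrightarrow> (\<And>b. queries_within V (k b)) \<Longrightarrow>
    queries_within V (ask_all qs k)"
  by (induction qs arbitrary: k) auto

text \<open>A rejected element stays rejected because \<open>passes\<close> is antitone and the kept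
  set only grows. \<open>G\<close> is the same for all continuations \<open>k\<close>, which lets
  nested scans be resolved one after another.\<close>

lemma result_scan:
  assumes "antimono (passes orc qs)" "passes orc qs B"
  obtains G where "B \<subseteq> G" "G \<subseteq> B \<union> set xs" "passes orc qs G"
    "\<forall>x\<in>set xs. x \<notin> G \<longrightarrow> \<not> passes orc qs (insert x G)"
    "\<forall>k. result orc (scan qs xs B k) = result orc (k G)"
proof -
  have "\<exists>G. B \<subseteq> G \<and> G \<subseteq> B \<union> set xs \<and> passes orc qs G \<and>
      (\<forall>x\<in>set xs. x \<notin> G \<longrightarrow> \<not> passes orc qs (insert x G)) \<and>
      (\<forall>k. result orc (scan qs xs B k) = result orc (k G))"
    using assms(2)
  proof (induction xs arbitrary: B)
    case Nil
    then show ?case by auto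
  next
    case (Cons x xs)
    let ?B = "if passes orc qs (insert x B) then insert x B else B"
    have "passes orc qs ?B" using Cons.prems by simp
    from Cons.IH[OF this] obtain G where G: "?B \<subseteq> G" "G \<subseteq> ?B \<union> set xs" "passes orc qs G"
      "\<forall>x\<in>set xs. x \<notin> G \<longrightarrow> \<not> passes orc qs (insert x G)"
      "\<forall>k. result orc (scan qs xs ?B k) = result orc (k G)" by blast
    have "x \<notin> G \<Longrightarrow> \<not> passes orc qs (insert x G)"
      using G(1) antimonoD[OF assms(1), of "insert x B" "insert x G"]
      by (auto split: if_splits)
    moreover have "result orc (scan qs (x # xs) B k) = result orc (k G)" for k
      using G(5) by (simp add: result_ask_all passes_def)
    moreover have "B \<subseteq> G" "G \<subseteq> B \<union> set (x # xs)" using G(1,2) by (auto split: if_splits)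
    ultimately show ?case using G(3,4) by (intro exI[of _ G]) auto
  qed
  then show thesis using that by blast
qed

lemma num_queries_scan:
  assumes "\<And>G. B \<subseteq> G \<Longrightarrow> G \<subseteq> B \<union> set xs \<Longrightarrow> num_queries orc (k G) \<le> m"
  shows "num_queries orc (scan qs xs B k) \<le> length qs * length xs + m"
  using assms
proof (induction xs arbitrary: B)
  case Nil
  then show ?case by simp
next
  case (Cons x xs)
  have "num_queries orc (scan qs xs (if b then insert x B else B) k)
      \<le> length qs * length xs + m" for b
    by (rule Cons.IH, rule Cons.prems) (auto split: if_splits)
  then show ?case by (simp add: num_queries_ask_all)
qed

lemma queries_within_scan:
  assumes "\<And>q. q \<in> set qs \<Longrightarrow> snd q \<subseteq> V" "set xs \<subseteq> V" "B \<subseteq> V"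
    and "\<And>G. B \<subseteq> G \<Longrightarrow> G \<subseteq> B \<union> set xs \<Longrightarrow> queries_within V (k G)"
  shows "queries_within V (scan qs xs B k)"
  using assms(2-)
proof (induction xs arbitrary: B)
  case Nil
  then show ?case by simp
next
  case (Cons x xs)
  have "queries_within V (scan qs xs (if b then insert x B else B) k)" for b
    by (rule Cons.IH; (rule Cons.prems)?) (use Cons.prems in \<open>auto split: if_splits\<close>)
  moreover have "snd q \<union> insert x B \<subseteq> V" if "q \<in> set qs" for q
    using assms(1)[OF that] Cons.prems by auto
  ultimately show ?case
    unfolding scan.simps by (intro queries_within_ask_all) fastforce+
qed

text \<open>The order depends on the set alone, so the algorithm is a deterministic function of the
  ground set.\<close>

definition list_of :: "'a set \<Rightarrow> 'a list" where
  "list_of A = (SOME xs. set xs = A \<and> distinct xs)"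

lemma list_of:
  assumes "finite A"
  shows "set (list_of A) = A" "length (list_of A) = card A"
proof -
  have "set (list_of A) = A \<and> distinct (list_of A)"
    unfolding list_of_def using someI_ex[OF finite_distinct_list[OF assms]] .
  then show "set (list_of A) = A" "length (list_of A) = card A"
    by (auto dest: distinct_card)
qed

lemma length_list_of_le:
  assumes "finite V" "A \<subseteq> V"
  shows "length (list_of A) \<le> card V"
  using assms by (simp add: list_of finite_subset card_mono)

section \<open>The algorithm\<close>

text \<open>The scans in turn extend \<open>B\<^sub>1\<close> to \<open>C\<^sub>1\<close>, drop from
  \<open>F\<close> what \<open>C\<^sub>1\<close> replaces in the second matroid, extend
  \<open>B\<^sub>2\<close>, refill \<open>R\<close> in the first matroid to size
  \<open>card S\<close>, and trim \<open>C\<^sub>1\<close> so that it fits the larger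
  \<open>R'\<close>. The number counts the rounds still to run.\<close>

primrec rounds :: "'a set \<Rightarrow> 'a set \<Rightarrow> nat \<Rightarrow> 'a set \<Rightarrow> 'a set \<Rightarrow> 'a set \<Rightarrow> 'a set \<Rightarrow> 'a oracle_alg"
where
  "rounds V S 0 R F B\<^sub>1 B\<^sub>2 = Output (R \<union> F \<union> B\<^sub>1 \<union> B\<^sub>2)"
| "rounds V S (Suc k) R F B\<^sub>1 B\<^sub>2 =
    scan [(First, S), (Second, R)] (list_of (V - S)) B\<^sub>1 (\<lambda>C\<^sub>1.
    scan [(Second, R \<union> C\<^sub>1)] (list_of F) {} (\<lambda>F'.
    scan [(First, R \<union> F'), (Second, S)] (list_of (V - S)) B\<^sub>2 (\<lambda>B\<^sub>2'.
    scan [(First, F' \<union> B\<^sub>2')] (list_of (S - F')) R (\<lambda>R'.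
    scan [(Second, R' \<union> F')] (list_of C\<^sub>1) {} (\<lambda>B\<^sub>1'.
    rounds V S k R' F' B\<^sub>1' B\<^sub>2')))))"

definition matroid_intersection_alg :: "nat \<Rightarrow> 'a set \<Rightarrow> 'a oracle_alg" where
  "matroid_intersection_alg k V =
    scan [(First, {}), (Second, {})] (list_of V) {} (\<lambda>S. rounds V S k {} S {} {})"

text \<open>The five scans ask 2, 1, 2, 1 and 1 queries per candidate, 7 in total, and no scan has
  more than \<open>card V\<close> candidates.\<close>

lemma num_queries_rounds:
  assumes "finite V" "S \<subseteq> V" "R \<subseteq> V" "F \<subseteq> V" "B\<^sub>1 \<subseteq> V" "B\<^sub>2 \<subseteq> V"
  shows "num_queries orc (rounds V S k R F B\<^sub>1 B\<^sub>2) \<le> k * (7 * card V)"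
  using assms(3-)
proof (induction k arbitrary: R F B\<^sub>1 B\<^sub>2)
  case 0
  then show ?case by simp
next
  case (Suc k)
  let ?n = "card V"
  note subs = assms(1,2) Suc.prems
  have scan_le: "num_queries orc (scan qs (list_of A) B c) \<le> m'"
    if "A \<subseteq> V" "length qs * ?n + m \<le> m'"
      "\<And>G. G \<subseteq> B \<union> A \<Longrightarrow> num_queries orc (c G) \<le> m" for qs A B c m m'
  proof -
    have "set (list_of A) = A" using that assms(1) by (simp add: list_of finite_subset)
    then have "num_queries orc (scan qs (list_of A) B c) \<le> length qs * length (list_of A) + m"
      using that by (intro num_queries_scan) auto
    also have "\<dots> \<le> length qs * ?n + m"
      using length_list_of_le[OF assms(1) that(1)] by simp
    finally show ?thesis using that(2) by simp
  qed
  have subs: "V - S \<subseteq> V" "S - A \<subseteq> V" for A using assms(2) by auto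
  show ?case
    unfolding rounds.simps
    \<comment> \<open>Each \<open>m\<close> below is the budget left for the later scans of this
      round and for the \<open>k\<close> remaining rounds.\<close>
    apply (rule scan_le[where m = "5 * ?n + k * (7 * ?n)"], fact subs, simp)
    subgoal premises C for C\<^sub>1
      apply (rule scan_le[where m = "4 * ?n + k * (7 * ?n)"], fact, simp)
      subgoal premises F' for F'
        apply (rule scan_le[where m = "2 * ?n + k * (7 * ?n)"], fact subs, simp)
        subgoal premises B\<^sub>2' for B\<^sub>2'
          apply (rule scan_le[where m = "?n + k * (7 * ?n)"], fact subs, simp)
          subgoal premises R' for R'
            apply (rule scan_le[where m = "k * (7 * ?n)"])
            subgoal using C Suc.prems by blast
            subgoal by simp
            subgoal premises B\<^sub>1' for B\<^sub>1'
            proof (rule Suc.IH)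
              show "R' \<subseteq> V" using R' Suc.prems assms(2) by blast
              show "F' \<subseteq> V" using F' Suc.prems by blast
              show "B\<^sub>1' \<subseteq> V" using B\<^sub>1' C Suc.prems by blast
              show "B\<^sub>2' \<subseteq> V" using B\<^sub>2' Suc.prems by blast
            qed
            done
          done
        done
      done
    done
qed

lemma queries_within_rounds:
  assumes "finite V" "S \<subseteq> V" "R \<subseteq> V" "F \<subseteq> V" "B\<^sub>1 \<subseteq> V" "B\<^sub>2 \<subseteq> V"
  shows "queries_within V (rounds V S k R F B\<^sub>1 B\<^sub>2)"
  using assms(3-)
proof (induction k arbitrary: R F B\<^sub>1 B\<^sub>2)
  case 0
  then show ?case by simp
next
  case (Suc k)
  note subs = assms(1,2) Suc.prems
  have scan: "queries_within V (scan qs (list_of A) B c)"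
    if "A \<subseteq> V" "B \<subseteq> V" "\<Union> (snd ` set qs) \<subseteq> V"
      "\<And>G. G \<subseteq> B \<union> A \<Longrightarrow> queries_within V (c G)" for qs A B c
  proof -
    have "set (list_of A) = A" using that assms(1) by (simp add: list_of finite_subset)
    then show ?thesis using that by (intro queries_within_scan) auto
  qed
  have subs: "V - S \<subseteq> V" "S - A \<subseteq> V" for A using assms(2) by auto
  show ?case
    unfolding rounds.simps
    apply (rule scan, fact subs, fact)
    subgoal using Suc.prems assms(2) by simp
    subgoal premises C for C\<^sub>1
    proof -
      have C: "C\<^sub>1 \<subseteq> V" using C Suc.prems by blast
      show ?thesis
        apply (rule scan, fact, simp)
        subgoal using C Suc.prems by simp
        subgoal premises F' for F'
        proof -
          have F': "F' \<subseteq> V" using F' Suc.prems by blast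
          show ?thesis
            apply (rule scan, fact subs, fact)
            subgoal using F' Suc.prems assms(2) by simp
            subgoal premises B\<^sub>2' for B\<^sub>2'
            proof -
              have B\<^sub>2': "B\<^sub>2' \<subseteq> V" using B\<^sub>2' Suc.prems by blast
              show ?thesis
                apply (rule scan, fact subs, fact)
                subgoal using F' B\<^sub>2' by simp
                subgoal premises R' for R'
                proof -
                  have R': "R' \<subseteq> V" using R' Suc.prems assms(2) by blast
                  show ?thesis
                    apply (rule scan, fact C, simp)
                    subgoal using F' R' by simp
                    subgoal premises B\<^sub>1' for B\<^sub>1'
                      by (rule Suc.IH[OF R' F' _ B\<^sub>2']) (use B\<^sub>1' C in blast)
                    done
                qed
                done
            qed
            done
        qed
        done
    qed
    done
qed

lemma num_queries_matroid_intersection_alg: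
  assumes "finite V"
  shows "num_queries orc (matroid_intersection_alg k V) \<le> (2 + 7 * k) * card V"
proof -
  have "num_queries orc (matroid_intersection_alg k V)
      \<le> length [(First, {}::'a set), (Second, {})] * length (list_of V) + k * (7 * card V)"
    unfolding matroid_intersection_alg_def using assms
    by (intro num_queries_scan num_queries_rounds) (auto simp: list_of)
  then show ?thesis using assms by (simp add: list_of algebra_simps)
qed

lemma queries_within_matroid_intersection_alg:
  assumes "finite V"
  shows "queries_within V (matroid_intersection_alg k V)"
  unfolding matroid_intersection_alg_def using assms
  by (intro queries_within_scan queries_within_rounds) (auto simp: list_of)

section \<open>Correctness\<close>

locale two_matroids = M1: matroid V \<I>\<^sub>1 + M2: matroid V \<I>\<^sub>2
  for V :: "'a set" and \<I>\<^sub>1 \<I>\<^sub>2 :: "'a set set"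
begin

abbreviation "orc \<equiv> indep_oracle \<I>\<^sub>1 \<I>\<^sub>2"

lemma antimono_passes: "antimono (passes orc qs)"
proof (rule antimonoI, rule le_boolI)
  fix A B :: "'a set" assume "A \<subseteq> B" "passes orc qs B"
  have "orc (fst q) (snd q \<union> A)" if "q \<in> set qs" for q
  proof -
    have "orc (fst q) (snd q \<union> B)" "snd q \<union> A \<subseteq> snd q \<union> B"
      using \<open>A \<subseteq> B\<close> \<open>passes orc qs B\<close> that by (auto simp: passes_def)
    then show ?thesis
      by (cases "fst q") (auto intro: M1.downward_closed M2.downward_closed)
  qed
  then show "passes orc qs A" by (simp add: passes_def)
qed

lemmas result_scan_obtain = result_scan[OF antimono_passes]

end

section \<open>Invariant and progress of one round\<close>

locale maximal_common_indep = two_matroids +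
  fixes S
  assumes S1: "S \<in> \<I>\<^sub>1" and S2: "S \<in> \<I>\<^sub>2"
    and maximal: "\<And>x. x \<in> V - S \<Longrightarrow> insert x S \<in> \<I>\<^sub>1 \<Longrightarrow> insert x S \<notin> \<I>\<^sub>2"
begin

lemma finite_sub: "A \<subseteq> V \<Longrightarrow> finite A"
  using M1.finite_ground finite_subset by blast

lemma S_sub: "S \<subseteq> V"
  using M1.indep_subset S1 by blast

text \<open>The last conjunct remembers that the scan for \<open>B\<^sub>2\<close> was exhaustive.
  It has \<open>F\<close> where that scan had \<open>R \<union> F\<close>, which saves
  \<open>card R\<close> in the rank bound of the next round.\<close>

definition invar :: "'a set \<Rightarrow> 'a set \<Rightarrow> 'a set \<Rightarrow> 'a set \<Rightarrow> bool" where
  "invar R F B\<^sub>1 B\<^sub>2 \<longleftrightarrow>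
    R \<subseteq> S \<and> F \<subseteq> S \<and> R \<inter> F = {} \<and> B\<^sub>1 \<subseteq> V - S \<and> B\<^sub>2 \<subseteq> V - S \<and>
    S \<union> B\<^sub>1 \<in> \<I>\<^sub>1 \<and> S \<union> B\<^sub>2 \<in> \<I>\<^sub>2 \<and> R \<union> F \<union> B\<^sub>1 \<in> \<I>\<^sub>2 \<and> R \<union> F \<union> B\<^sub>2 \<in> \<I>\<^sub>1 \<and>
    card R + card F + card B\<^sub>1 = card S \<and> card R + card F + card B\<^sub>2 = card S \<and>
    V \<subseteq> M2.span (S \<union> B\<^sub>2) \<union> M1.span (F \<union> B\<^sub>2)"

lemma spanned2:
  assumes "S \<union> B \<in> \<I>\<^sub>1" "B \<subseteq> V - S" "A \<subseteq> S \<union> B"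
  shows "A \<subseteq> M2.span S"
proof
  fix x assume "x \<in> A"
  have "insert x S \<notin> \<I>\<^sub>2" if "x \<notin> S"
    using maximal[of x] M1.downward_closed[OF assms(1), of "insert x S"] assms that \<open>x \<in> A\<close>
    by blast
  then show "x \<in> M2.span S" using assms \<open>x \<in> A\<close> S_sub unfolding M2.span_def by blast
qed

lemma spanned1:
  assumes "S \<union> B \<in> \<I>\<^sub>2" "B \<subseteq> V - S" "A \<subseteq> S \<union> B"
  shows "A \<subseteq> M1.span S"
proof
  fix x assume "x \<in> A"
  have "insert x S \<notin> \<I>\<^sub>1" if "x \<notin> S"
    using maximal[of x] M2.downward_closed[OF assms(1), of "insert x S"] assms that \<open>x \<in> A\<close>
    by blast
  then show "x \<in> M1.span S" using assms \<open>x \<in> A\<close> S_sub unfolding M1.span_def by blast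
qed

lemma card_Un3:
  assumes "R \<subseteq> S" "F \<subseteq> S" "R \<inter> F = {}" "B \<subseteq> V - S"
  shows "card (R \<union> F \<union> B) = card R + card F + card B"
proof -
  have "finite R" "finite F" "finite B" using assms S_sub by (auto intro!: finite_sub)
  moreover have "(R \<union> F) \<inter> B = {}" using assms by blast
  ultimately show ?thesis using assms by (simp add: card_Un_disjoint)
qed

lemma invar_init: "invar {} S {} {}"
  using S1 S2 maximal S_sub unfolding invar_def M1.span_def M2.span_def by auto

text \<open>The third conclusion is the progress estimate: the gap
  \<open>2 * card T - 3 * (card S + card B\<^sub>2')\<close> is paid for by the growth of
  \<open>R\<close>. It holds for every common independent \<open>T\<close>.\<close>

lemma round_invar:
  assumes inv: "invar R F B\<^sub>1 B\<^sub>2"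
  obtains R' F' B\<^sub>1' B\<^sub>2' where
    "invar R' F' B\<^sub>1' B\<^sub>2'" "card B\<^sub>2 \<le> card B\<^sub>2'"
    "\<And>T. T \<in> \<I>\<^sub>1 \<Longrightarrow> T \<in> \<I>\<^sub>2 \<Longrightarrow> 2 * card T + card R \<le> 3 * (card S + card B\<^sub>2') + card R'"
    "\<And>k. result orc (rounds V S (Suc k) R F B\<^sub>1 B\<^sub>2) = result orc (rounds V S k R' F' B\<^sub>1' B\<^sub>2')"
proof -
  note inv' = inv[unfolded invar_def]
  have sub: "R \<subseteq> S" "F \<subseteq> S" "R \<inter> F = {}" "B\<^sub>1 \<subseteq> V - S" "B\<^sub>2 \<subseteq> V - S" using inv' by auto
  have fin: "finite (V - S)" "finite F" using sub S_sub by (auto intro!: finite_sub)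

  have "passes orc [(First, S), (Second, R)] B\<^sub>1"
    using inv' by (auto simp: passes_def intro: M2.downward_closed)
  then obtain C where C: "B\<^sub>1 \<subseteq> C" "C \<subseteq> B\<^sub>1 \<union> set (list_of (V - S))"
    "passes orc [(First, S), (Second, R)] C"
    "\<forall>x\<in>set (list_of (V - S)). x \<notin> C \<longrightarrow>
       \<not> passes orc [(First, S), (Second, R)] (insert x C)"
    and resC: "\<forall>k. result orc (scan [(First, S), (Second, R)] (list_of (V - S)) B\<^sub>1 k)
       = result orc (k C)"
    by (rule result_scan_obtain[where xs = "list_of (V - S)"])
  have C_sub: "C \<subseteq> V - S" using C(2) sub list_of(1)[OF fin(1)] by auto
  have C1: "S \<union> C \<in> \<I>\<^sub>1" and C2: "R \<union> C \<in> \<I>\<^sub>2" using C(3) by (auto simp: passes_def)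
  have C_max: "insert x (S \<union> C) \<notin> \<I>\<^sub>1 \<or> insert x (R \<union> C) \<notin> \<I>\<^sub>2" if "x \<in> V - S" "x \<notin> C" for x
    using C(4)[rule_format, of x] that list_of(1)[OF fin(1)] by (auto simp: passes_def)
  have finC: "finite C" using C_sub by (auto intro: finite_sub)

  have "passes orc [(Second, R \<union> C)] {}" using C2 by (simp add: passes_def)
  then obtain F' where "{} \<subseteq> F'" and F': "F' \<subseteq> {} \<union> set (list_of F)"
    "passes orc [(Second, R \<union> C)] F'"
    "\<forall>x\<in>set (list_of F). x \<notin> F' \<longrightarrow> \<not> passes orc [(Second, R \<union> C)] (insert x F')"
    and resF: "\<forall>k. result orc (scan [(Second, R \<union> C)] (list_of F) {} k) = result orc (k F')"
    by (rule result_scan_obtain[where xs = "list_of F"])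
  have F_sub: "F' \<subseteq> F" using F'(1) list_of(1)[OF fin(2)] by auto
  have F2: "R \<union> F' \<union> C \<in> \<I>\<^sub>2" using F'(2) by (simp add: passes_def Un_ac)
  have F_max: "insert x (R \<union> F' \<union> C) \<notin> \<I>\<^sub>2" if "x \<in> F" "x \<notin> F'" for x
    using F'(3)[rule_format, of x] that list_of(1)[OF fin(2)] by (simp add: passes_def Un_ac)
  have F_S: "F' \<subseteq> S" "R \<inter> F' = {}" using F_sub sub by auto
  \<comment> \<open>Everything lies in the second span of \<open>S\<close>, which gives the upper
    bound. For the lower bound, augment from \<open>R \<union> F \<union> B\<^sub>1\<close>, of size
    \<open>card S\<close>: as \<open>B\<^sub>1 \<subseteq> C\<close>, the new element would be one
    of \<open>F\<close> that the scan rejected.\<close>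
  have cardF: "card R + card F' + card C = card S"
  proof (rule antisym)
    have "R \<union> F' \<union> C \<subseteq> M2.span S" by (rule spanned2[OF C1 C_sub]) (use sub F_S in blast)
    from M2.card_le_if_spanned[OF F2 S2 this]
    show "card R + card F' + card C \<le> card S" using card_Un3[OF sub(1) F_S C_sub] by simp
    show "card S \<le> card R + card F' + card C"
    proof (rule ccontr)
      assume "\<not> ?thesis"
      then have "card (R \<union> F' \<union> C) < card (R \<union> F \<union> B\<^sub>1)"
        using card_Un3[OF sub(1) F_S C_sub] card_Un3[OF sub(1-4)] inv' by simp
      then obtain x where "x \<in> (R \<union> F \<union> B\<^sub>1) - (R \<union> F' \<union> C)" "insert x (R \<union> F' \<union> C) \<in> \<I>\<^sub>2"
        using M2.augmentation[OF F2] inv' by blast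
      then show False using F_max[of x] C(1) by blast
    qed
  qed

  have "passes orc [(First, R \<union> F'), (Second, S)] B\<^sub>2"
    using inv' F_sub by (auto simp: passes_def intro: M1.downward_closed)
  then obtain D where D: "B\<^sub>2 \<subseteq> D" "D \<subseteq> B\<^sub>2 \<union> set (list_of (V - S))"
    "passes orc [(First, R \<union> F'), (Second, S)] D"
    "\<forall>x\<in>set (list_of (V - S)). x \<notin> D \<longrightarrow>
       \<not> passes orc [(First, R \<union> F'), (Second, S)] (insert x D)"
    and resD: "\<forall>k. result orc (scan [(First, R \<union> F'), (Second, S)] (list_of (V - S)) B\<^sub>2 k)
       = result orc (k D)"
    by (rule result_scan_obtain[where xs = "list_of (V - S)"])
  have D_sub: "D \<subseteq> V - S" using D(2) sub list_of(1)[OF fin(1)] by auto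
  have D1: "R \<union> F' \<union> D \<in> \<I>\<^sub>1" and D2: "S \<union> D \<in> \<I>\<^sub>2" using D(3) by (auto simp: passes_def)
  have D_max: "insert x (R \<union> F' \<union> D) \<notin> \<I>\<^sub>1 \<or> insert x (S \<union> D) \<notin> \<I>\<^sub>2" if "x \<in> V - S" "x \<notin> D" for x
    using D(4)[rule_format, of x] that list_of(1)[OF fin(1)] by (auto simp: passes_def)
  have finD: "finite D" using D_sub by (auto intro: finite_sub)

  \<comment> \<open>Outside \<open>B\<^sub>2\<close>, such a \<open>y\<close> is not in the second
    span of \<open>S \<union> B\<^sub>2\<close>, so the covering in the old invariant puts it into
    the first span.\<close>
  have in_old_span: "y \<in> M1.span (F \<union> B\<^sub>2)" if "y \<in> V - S" "insert y (S \<union> B\<^sub>2) \<in> \<I>\<^sub>2" for y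
  proof (cases "y \<in> B\<^sub>2")
    case True
    then show ?thesis using that by (simp add: M1.span_def)
  next
    case False
    then show ?thesis using inv' that by (auto simp: M2.span_def)
  qed
  txt \<open>In the contraction of the first matroid by \<open>F' \<union> B\<^sub>2\<close>, the set \<open>R\<close> is skew to \<open>F\<close>, whose span
    contains \<open>D\<close> and \<open>x\<close>. Hence maximality of \<open>D\<close> relative to \<open>R \<union> F'\<close> gives it relative to \<open>F'\<close>.\<close>
  have cover2: "x \<in> M2.span (S \<union> D) \<union> M1.span (F' \<union> D)" if "x \<in> V" for x
  proof (rule ccontr)
    assume "\<not> ?thesis"
    then have x: "x \<notin> S" "x \<notin> D" "insert x (S \<union> D) \<in> \<I>\<^sub>2" "insert x (F' \<union> D) \<in> \<I>\<^sub>1"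
      using that by (auto simp: M1.span_def M2.span_def)
    have "y \<in> M1.span (F \<union> B\<^sub>2)" if "y \<in> insert x D" for y
    proof (rule in_old_span)
      show "y \<in> V - S" using that D_sub x \<open>x \<in> V\<close> by blast
      show "insert y (S \<union> B\<^sub>2) \<in> \<I>\<^sub>2"
        using that D(1) by (intro M2.downward_closed[OF x(3)]) blast
    qed
    moreover have "F' \<subseteq> M1.span (F \<union> B\<^sub>2)" using F_sub sub S_sub by (auto simp: M1.span_def)
    ultimately have "insert x (F' \<union> D) \<subseteq> M1.span (F \<union> B\<^sub>2)" by blast
    moreover have "R \<union> (F \<union> B\<^sub>2) \<in> \<I>\<^sub>1" using inv' by (simp add: Un_ac)
    moreover have "R \<inter> (F \<union> B\<^sub>2) = {}" using sub by blast
    ultimately have "R \<union> insert x (F' \<union> D) \<in> \<I>\<^sub>1"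
      using M1.indep_Un_if_spanned[OF x(4)] by blast
    then show False using D_max[of x] x that by (simp add: Un_ac)
  qed

  have finSF: "finite (S - F')" using S_sub by (auto intro: finite_sub)
  have "passes orc [(First, F' \<union> D)] R" using D1 by (simp add: passes_def Un_ac)
  then obtain R' where R': "R \<subseteq> R'" "R' \<subseteq> R \<union> set (list_of (S - F'))"
    "passes orc [(First, F' \<union> D)] R'"
    "\<forall>x\<in>set (list_of (S - F')). x \<notin> R' \<longrightarrow> \<not> passes orc [(First, F' \<union> D)] (insert x R')"
    and resR: "\<forall>k. result orc (scan [(First, F' \<union> D)] (list_of (S - F')) R k) = result orc (k R')"
    by (rule result_scan_obtain[where xs = "list_of (S - F')"])
  have R_sub: "R' \<subseteq> S" "R' \<inter> F' = {}" using R'(2) list_of(1)[OF finSF] sub F_S by auto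
  have R1: "R' \<union> F' \<union> D \<in> \<I>\<^sub>1" using R'(3) by (simp add: passes_def Un_ac)
  have R_max: "insert x (R' \<union> F' \<union> D) \<notin> \<I>\<^sub>1" if "x \<in> S - F'" "x \<notin> R'" for x
    using R'(4)[rule_format, of x] that list_of(1)[OF finSF] by (simp add: passes_def Un_ac)
  \<comment> \<open>As for \<open>cardF\<close>, now in the first matroid and augmenting from
    \<open>S\<close> itself.\<close>
  have cardR: "card R' + card F' + card D = card S"
  proof (rule antisym)
    have "R' \<union> F' \<union> D \<subseteq> M1.span S" by (rule spanned1[OF D2 D_sub]) (use R_sub F_S in blast)
    from M1.card_le_if_spanned[OF R1 S1 this]
    show "card R' + card F' + card D \<le> card S"
      using card_Un3[OF R_sub(1) F_S(1) R_sub(2) D_sub] by simp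
    show "card S \<le> card R' + card F' + card D"
    proof (rule ccontr)
      assume "\<not> ?thesis"
      then have "card (R' \<union> F' \<union> D) < card S"
        using card_Un3[OF R_sub(1) F_S(1) R_sub(2) D_sub] by simp
      then obtain x where "x \<in> S - (R' \<union> F' \<union> D)" "insert x (R' \<union> F' \<union> D) \<in> \<I>\<^sub>1"
        using M1.augmentation[OF R1 S1] by blast
      then show False using R_max[of x] by blast
    qed
  qed

  have RF2: "R' \<union> F' \<in> \<I>\<^sub>2" by (rule M2.downward_closed[OF S2]) (use R_sub F_S in blast)
  have "passes orc [(Second, R' \<union> F')] {}" using RF2 by (simp add: passes_def)
  then obtain B where "{} \<subseteq> B" and B: "B \<subseteq> {} \<union> set (list_of C)"
    "passes orc [(Second, R' \<union> F')] B"
    "\<forall>x\<in>set (list_of C). x \<notin> B \<longrightarrow> \<not> passes orc [(Second, R' \<union> F')] (insert x B)"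
    and resB: "\<forall>k. result orc (scan [(Second, R' \<union> F')] (list_of C) {} k) = result orc (k B)"
    by (rule result_scan_obtain[where xs = "list_of C"])
  have B_C: "B \<subseteq> C" using B(1) list_of(1)[OF finC] by auto
  then have B_sub: "B \<subseteq> V - S" using C_sub by blast
  have B1: "S \<union> B \<in> \<I>\<^sub>1" by (rule M1.downward_closed[OF C1]) (use B_C in blast)
  have B2: "R' \<union> F' \<union> B \<in> \<I>\<^sub>2" using B(2) by (simp add: passes_def)
  have B_max: "insert x (R' \<union> F' \<union> B) \<notin> \<I>\<^sub>2" if "x \<in> C" "x \<notin> B" for x
    using B(3)[rule_format, of x] that list_of(1)[OF finC] by (simp add: passes_def)
  \<comment> \<open>Here the augmentation is from \<open>R \<union> F' \<union> C\<close>, of size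
    \<open>card S\<close> by \<open>cardF\<close>. Since \<open>R \<subseteq> R'\<close>, the new
    element would be a rejected one of \<open>C\<close>.\<close>
  have cardB: "card R' + card F' + card B = card S"
  proof (rule antisym)
    have "R' \<union> F' \<union> B \<subseteq> M2.span S" by (rule spanned2[OF B1 B_sub]) (use R_sub F_S in blast)
    from M2.card_le_if_spanned[OF B2 S2 this]
    show "card R' + card F' + card B \<le> card S"
      using card_Un3[OF R_sub(1) F_S(1) R_sub(2) B_sub] by simp
    show "card S \<le> card R' + card F' + card B"
    proof (rule ccontr)
      assume "\<not> ?thesis"
      then have "card (R' \<union> F' \<union> B) < card (R \<union> F' \<union> C)"
        using card_Un3[OF R_sub(1) F_S(1) R_sub(2) B_sub] card_Un3[OF sub(1) F_S C_sub] cardF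
        by simp
      then obtain x where "x \<in> (R \<union> F' \<union> C) - (R' \<union> F' \<union> B)" "insert x (R' \<union> F' \<union> B) \<in> \<I>\<^sub>2"
        using M2.augmentation[OF B2 F2] by blast
      then show False using B_max[of x] R'(1) by blast
    qed
  qed

  have "V \<subseteq> M2.span (S \<union> D) \<union> M1.span (F' \<union> D)" using cover2 by blast
  then have inv_new: "invar R' F' B D"
    unfolding invar_def by (intro conjI R_sub F_S B_sub D_sub B1 D2 B2 R1 cardB cardR)
  have mono: "card B\<^sub>2 \<le> card D" using D(1) finD by (simp add: card_mono)

  have bound: "2 * card T + card R \<le> 3 * (card S + card D) + card R'"
    if T: "T \<in> \<I>\<^sub>1" "T \<in> \<I>\<^sub>2" for T
  proof -
    have TV: "T \<subseteq> V" and finT: "finite T"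
      using T M1.indep_subset M1.indep_finite by auto
    have FD: "F' \<union> D \<in> \<I>\<^sub>1" by (rule M1.downward_closed[OF D1]) blast
    \<comment> \<open>First rank bound: exhaustiveness of the scan for \<open>C\<close> covers
      \<open>V - S\<close>, and \<open>S\<close> lies in the first span.\<close>
    have "T \<subseteq> (T \<inter> M1.span (S \<union> C)) \<union> (T \<inter> M2.span (R \<union> C))"
      using TV C_max by (auto simp: M1.span_def M2.span_def)
    then have "card T \<le> card (T \<inter> M1.span (S \<union> C)) + card (T \<inter> M2.span (R \<union> C))"
      using finT by (meson card_Un_le card_mono finite_Int finite_UnI le_trans)
    also have "\<dots> \<le> card (S \<union> C) + card (R \<union> C)"
      using M1.card_Int_span_le[OF T(1) C1] M2.card_Int_span_le[OF T(2) C2] by simp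
    also have "\<dots> \<le> (card S + card C) + (card R + card C)"
      by (intro add_mono card_Un_le)
    finally have le1: "card T \<le> (card S + card C) + (card R + card C)" .
    have "T \<subseteq> (T \<inter> M2.span (S \<union> D)) \<union> (T \<inter> M1.span (F' \<union> D))"
      using TV cover2 by blast
    then have "card T \<le> card (T \<inter> M2.span (S \<union> D)) + card (T \<inter> M1.span (F' \<union> D))"
      using finT by (meson card_Un_le card_mono finite_Int finite_UnI le_trans)
    also have "\<dots> \<le> card (S \<union> D) + card (F' \<union> D)"
      using M2.card_Int_span_le[OF T(2) D2] M1.card_Int_span_le[OF T(1) FD] by simp
    also have "\<dots> \<le> (card S + card D) + (card F' + card D)"
      by (intro add_mono card_Un_le)
    \<comment> \<open>Eliminating \<open>card C\<close> by \<open>cardF\<close> turns the bounds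
      into \<open>card T \<le> 3 * card S - card R - 2 * card F'\<close> and
      \<open>card T \<le> card S + card F' + 2 * card D\<close>. Add them and substitute
      \<open>card F'\<close> from \<open>cardR\<close>.\<close>
    finally show ?thesis using le1 cardF cardR by simp
  qed

  have "result orc (rounds V S (Suc k) R F B\<^sub>1 B\<^sub>2) = result orc (rounds V S k R' F' B D)" for k
    by (simp add: resC resF resD resR resB)
  from inv_new mono bound this show thesis by (rule that)
qed

text \<open>Here \<open>j\<close> counts the rounds already charged to \<open>R\<close>, and
  \<open>R \<subseteq> S\<close> caps the total charge. Integers are used because the gap may be
  negative.\<close>

lemma rounds_correct:
  assumes "invar R F B\<^sub>1 B\<^sub>2" "T \<in> \<I>\<^sub>1" "T \<in> \<I>\<^sub>2"
    and "int j * (2 * int (card T) - 3 * (int (card S) + int (card B\<^sub>2))) \<le> int (card R)"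
  shows "result orc (rounds V S k R F B\<^sub>1 B\<^sub>2) \<in> \<I>\<^sub>1 \<inter> \<I>\<^sub>2 \<and>
    int (j + k) * (2 * int (card T) - 3 * int (card (result orc (rounds V S k R F B\<^sub>1 B\<^sub>2))))
      \<le> int (card S)"
  using assms(1,4)
proof (induction k arbitrary: R F B\<^sub>1 B\<^sub>2 j)
  case 0
  note inv = 0(1)[unfolded invar_def]
  let ?X = "R \<union> F \<union> B\<^sub>1 \<union> B\<^sub>2"
  \<comment> \<open>In the first matroid \<open>S \<union> B\<^sub>1\<close> is independent, so
    \<open>S\<close> may be exchanged there for \<open>R \<union> F \<union> B\<^sub>2\<close>,
    which it spans. The second matroid is symmetric.\<close>
  have "R \<union> F \<union> B\<^sub>2 \<subseteq> M1.span S" "R \<union> F \<union> B\<^sub>1 \<subseteq> M2.span S"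
    using inv by (intro spanned1[of B\<^sub>2] spanned2[of B\<^sub>1]; blast)+
  moreover have "B\<^sub>1 \<union> S \<in> \<I>\<^sub>1" "B\<^sub>2 \<union> S \<in> \<I>\<^sub>2" "B\<^sub>1 \<inter> S = {}" "B\<^sub>2 \<inter> S = {}"
    using inv by (auto simp: Un_commute)
  ultimately have "B\<^sub>1 \<union> (R \<union> F \<union> B\<^sub>2) \<in> \<I>\<^sub>1" "B\<^sub>2 \<union> (R \<union> F \<union> B\<^sub>1) \<in> \<I>\<^sub>2"
    using inv M1.indep_Un_if_spanned[of "R \<union> F \<union> B\<^sub>2" S B\<^sub>1]
      M2.indep_Un_if_spanned[of "R \<union> F \<union> B\<^sub>1" S B\<^sub>2] by blast+
  then have X: "?X \<in> \<I>\<^sub>1 \<inter> \<I>\<^sub>2" by (simp add: Un_ac)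
  \<comment> \<open>A common element could be added to \<open>S\<close> in both matroids, against
    maximality.\<close>
  have B12: "B\<^sub>1 \<inter> B\<^sub>2 = {}"
  proof (rule ccontr)
    assume "B\<^sub>1 \<inter> B\<^sub>2 \<noteq> {}"
    then obtain x where x: "x \<in> B\<^sub>1" "x \<in> B\<^sub>2" by blast
    then have "insert x S \<in> \<I>\<^sub>1" "insert x S \<in> \<I>\<^sub>2"
      using inv M1.downward_closed[of "S \<union> B\<^sub>1" "insert x S"]
        M2.downward_closed[of "S \<union> B\<^sub>2" "insert x S"] by auto
    then show False using maximal[of x] x inv by blast
  qed
  have fin: "finite (R \<union> F \<union> B\<^sub>1)" "finite B\<^sub>2" "finite S" "finite R"
    using inv S_sub by (auto intro!: finite_sub)
  have "card ?X = card (R \<union> F \<union> B\<^sub>1) + card B\<^sub>2"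
    using fin B12 inv by (intro card_Un_disjoint) auto
  then have "card ?X = card S + card B\<^sub>2"
    using card_Un3[of R F B\<^sub>1] inv by simp
  moreover have "card R \<le> card S" using fin inv by (simp add: card_mono)
  ultimately show ?case using X 0(2) by simp
next
  case (Suc k)
  from round_invar[OF Suc.prems(1)] obtain R' F' B\<^sub>1' B\<^sub>2' where
    new: "invar R' F' B\<^sub>1' B\<^sub>2'" "card B\<^sub>2 \<le> card B\<^sub>2'"
    "\<And>T. T \<in> \<I>\<^sub>1 \<Longrightarrow> T \<in> \<I>\<^sub>2 \<Longrightarrow> 2 * card T + card R \<le> 3 * (card S + card B\<^sub>2') + card R'"
    and res: "\<And>k. result orc (rounds V S (Suc k) R F B\<^sub>1 B\<^sub>2)
      = result orc (rounds V S k R' F' B\<^sub>1' B\<^sub>2')" by blast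
  let ?d = "\<lambda>b. 2 * int (card T) - 3 * (int (card S) + int b)"
  have "int (Suc j) * ?d (card B\<^sub>2') = int j * ?d (card B\<^sub>2') + ?d (card B\<^sub>2')"
    by (simp add: algebra_simps)
  \<comment> \<open>The gap shrinks as \<open>B\<^sub>2\<close> grows, so the earlier rounds also
    pay for \<open>j\<close> copies of the new gap.\<close>
  also have "int j * ?d (card B\<^sub>2') \<le> int j * ?d (card B\<^sub>2)"
    using new(2) by (intro mult_left_mono) auto
  also have "\<dots> \<le> int (card R)" by (rule Suc.prems(2))
  also have "int (card R) + ?d (card B\<^sub>2') \<le> int (card R')"
    using new(3)[OF assms(2,3), folded of_nat_le_iff[where 'a = int]] by simp
  finally have "int (Suc j) * ?d (card B\<^sub>2') \<le> int (card R')" by simp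
  from Suc.IH[OF new(1) this] show ?case unfolding res by simp
qed

end

section \<open>Approximation ratio and query count\<close>

context two_matroids
begin

text \<open>The first scan yields a maximal \<open>S\<close>, and the rounds start with nothing
  charged, that is with \<open>j = 0\<close>. Finally \<open>card S \<le> card T\<close> because
  \<open>T\<close> is maximum.\<close>

lemma matroid_intersection_alg_correct:
  fixes k :: nat
  assumes "T \<in> \<I>\<^sub>1" "T \<in> \<I>\<^sub>2" "\<And>A. A \<in> \<I>\<^sub>1 \<Longrightarrow> A \<in> \<I>\<^sub>2 \<Longrightarrow> card A \<le> card T"
  defines "X \<equiv> result orc (matroid_intersection_alg k V)"
  shows "X \<in> \<I>\<^sub>1 \<inter> \<I>\<^sub>2" "int k * (2 * int (card T) - 3 * int (card X)) \<le> int (card T)"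
proof -
  have "passes orc [(First, {}), (Second, {})] {}"
    using M1.indep_empty M2.indep_empty by (simp add: passes_def)
  then obtain S where "{} \<subseteq> S" "S \<subseteq> {} \<union> set (list_of V)"
    and S: "passes orc [(First, {}), (Second, {})] S"
    "\<forall>x\<in>set (list_of V). x \<notin> S \<longrightarrow>
      \<not> passes orc [(First, {}), (Second, {})] (insert x S)"
    and res: "\<forall>k. result orc (scan [(First, {}), (Second, {})] (list_of V) {} k)
      = result orc (k S)"
    by (rule result_scan_obtain[where xs = "list_of V"])
  have S12: "S \<in> \<I>\<^sub>1" "S \<in> \<I>\<^sub>2" using S(1) by (auto simp: passes_def)
  interpret maximal_common_indep V \<I>\<^sub>1 \<I>\<^sub>2 S
    by unfold_locales
      (use S12 S(2) list_of(1)[OF M1.finite_ground] in \<open>auto simp: passes_def\<close>)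
  have X: "X = result orc (rounds V S k {} S {} {})"
    unfolding X_def matroid_intersection_alg_def by (simp add: res)
  have "X \<in> \<I>\<^sub>1 \<inter> \<I>\<^sub>2 \<and> int (0 + k) * (2 * int (card T) - 3 * int (card X)) \<le> int (card S)"
    unfolding X by (rule rounds_correct[OF invar_init assms(1,2)]) simp
  then show "X \<in> \<I>\<^sub>1 \<inter> \<I>\<^sub>2" "int k * (2 * int (card T) - 3 * int (card X)) \<le> int (card T)"
    using assms(3)[OF S12] by auto
qed

lemma max_common_indep_attained:
  obtains T where "T \<in> \<I>\<^sub>1" "T \<in> \<I>\<^sub>2" "card T = max_common_indep \<I>\<^sub>1 \<I>\<^sub>2"
    "\<And>A. A \<in> \<I>\<^sub>1 \<Longrightarrow> A \<in> \<I>\<^sub>2 \<Longrightarrow> card A \<le> card T"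
proof -
  have "\<I>\<^sub>1 \<inter> \<I>\<^sub>2 \<subseteq> Pow V" using M1.indep_subset by blast
  then have fin: "finite (card ` (\<I>\<^sub>1 \<inter> \<I>\<^sub>2))"
    using M1.finite_ground by (meson finite_Pow_iff finite_imageI finite_subset)
  have "card ` (\<I>\<^sub>1 \<inter> \<I>\<^sub>2) \<noteq> {}" using M1.indep_empty M2.indep_empty by blast
  from Max_in[OF fin this] obtain T where T: "T \<in> \<I>\<^sub>1" "T \<in> \<I>\<^sub>2"
    "card T = max_common_indep \<I>\<^sub>1 \<I>\<^sub>2" unfolding max_common_indep_def by auto
  moreover have "card A \<le> card T" if "A \<in> \<I>\<^sub>1" "A \<in> \<I>\<^sub>2" for A
    unfolding T(3) max_common_indep_def using fin that by (intro Max_ge) auto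
  ultimately show thesis using that by blast
qed

end

lemma matroid_intersection_alg_ratio:
  fixes k :: nat
  assumes "matroid V \<I>\<^sub>1" "matroid V \<I>\<^sub>2" "\<epsilon> > 0" "k = nat \<lceil>1 / \<epsilon>\<rceil>"
  defines "X \<equiv> result (indep_oracle \<I>\<^sub>1 \<I>\<^sub>2) (matroid_intersection_alg k V)"
  shows "X \<in> \<I>\<^sub>1 \<inter> \<I>\<^sub>2" "real (card X) \<ge> (2 / 3 - \<epsilon>) * real (max_common_indep \<I>\<^sub>1 \<I>\<^sub>2)"
proof -
  interpret two_matroids V \<I>\<^sub>1 \<I>\<^sub>2 using assms(1,2) by (simp add: two_matroids_def)
  obtain T where T: "T \<in> \<I>\<^sub>1" "T \<in> \<I>\<^sub>2" "card T = max_common_indep \<I>\<^sub>1 \<I>\<^sub>2"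
    "\<And>A. A \<in> \<I>\<^sub>1 \<Longrightarrow> A \<in> \<I>\<^sub>2 \<Longrightarrow> card A \<le> card T"
    using max_common_indep_attained by blast
  note correct = matroid_intersection_alg_correct[OF T(1,2,4), of k, folded X_def]
  show "X \<in> \<I>\<^sub>1 \<inter> \<I>\<^sub>2" by (rule correct)
  let ?g = "2 * real (card T) - 3 * real (card X)"
  have k: "1 / \<epsilon> \<le> real k" using assms(4) by (simp add: real_nat_ceiling_ge)
  have "real_of_int (int k * (2 * int (card T) - 3 * int (card X))) \<le> real_of_int (int (card T))"
    using correct(2) by (rule of_int_le_iff[THEN iffD2])
  then have kg: "real k * ?g \<le> real (card T)" by simp
  have "?g \<le> \<epsilon> * real (card T)"
  \<comment> \<open>Replacing \<open>k\<close> by the smaller \<open>1 / \<epsilon>\<close> is sound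
    only for a nonnegative gap.\<close>
  proof (cases "?g \<le> 0")
    case True
    moreover have "0 \<le> \<epsilon> * real (card T)" using assms(3) by simp
    ultimately show ?thesis by linarith
  next
    case False
    then have "1 / \<epsilon> * ?g \<le> real k * ?g" using k by (intro mult_right_mono) auto
    then have "1 / \<epsilon> * ?g \<le> real (card T)" using kg by linarith
    then show ?thesis using assms(3) by (simp add: field_simps)
  qed
  \<comment> \<open>Dividing the gap by 3 loses only \<epsilon>/3 of the optimum; this inequality
    relaxes the loss to \<epsilon>.\<close>
  moreover have "0 \<le> \<epsilon> * real (card T)" using assms(3) by simp
  ultimately have "3 * real (card X) \<ge> 3 * ((2 / 3 - \<epsilon>) * real (card T))"
    by (simp add: algebra_simps)
  then show "real (card X) \<ge> (2 / 3 - \<epsilon>) * real (max_common_indep \<I>\<^sub>1 \<I>\<^sub>2)"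
    by (simp add: T(3))
qed

theorem theorem1:
  "\<exists>C::real. C > 0 \<and>
     (\<forall>\<epsilon>::real. \<epsilon> > 0 \<longrightarrow>
       (\<exists>alg :: 'a set \<Rightarrow> 'a oracle_alg.
          \<forall>V. finite V \<longrightarrow>
            queries_within V (alg V) \<and>
            (\<forall>\<I>\<^sub>1 \<I>\<^sub>2. matroid V \<I>\<^sub>1 \<and> matroid V \<I>\<^sub>2 \<longrightarrow>
              (let n = card V;
                   r = max_common_indep \<I>\<^sub>1 \<I>\<^sub>2;
                   orc = indep_oracle \<I>\<^sub>1 \<I>\<^sub>2;
                   S = result orc (alg V)
               in S \<in> \<I>\<^sub>1 \<inter> \<I>\<^sub>2 \<and>
                  real (card S) \<ge> (2 / 3 - \<epsilon>) * real r \<and>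
                  real (num_queries orc (alg V))
                    \<le> C * (real n / \<epsilon> + real r * log 2 (real r))))))"
proof (intro exI[of _ "16::real"] conjI allI impI)
  fix \<epsilon> :: real assume \<epsilon>: "\<epsilon> > 0"
  have rlog: "0 \<le> real r * log 2 (real r)" for r :: nat
    by (cases "r = 0") auto
  show "\<exists>alg :: 'a set \<Rightarrow> 'a oracle_alg.
          \<forall>V. finite V \<longrightarrow>
            queries_within V (alg V) \<and>
            (\<forall>\<I>\<^sub>1 \<I>\<^sub>2. matroid V \<I>\<^sub>1 \<and> matroid V \<I>\<^sub>2 \<longrightarrow>
              (let n = card V;
                   r = max_common_indep \<I>\<^sub>1 \<I>\<^sub>2;
                   orc = indep_oracle \<I>\<^sub>1 \<I>\<^sub>2;
                   S = result orc (alg V)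
               in S \<in> \<I>\<^sub>1 \<inter> \<I>\<^sub>2 \<and>
                  real (card S) \<ge> (2 / 3 - \<epsilon>) * real r \<and>
                  real (num_queries orc (alg V))
                    \<le> 16 * (real n / \<epsilon> + real r * log 2 (real r))))"
  proof (cases "\<epsilon> \<ge> 1")
    case True
    \<comment> \<open>The required size is at most 0 here, so the empty set suffices with no
      queries. For large \<epsilon> even one pass over \<open>V\<close> could exceed a multiple of
      n/\<epsilon>.\<close>
    have "{} \<in> \<I>" if "matroid V \<I>" for V and \<I> :: "'a set set"
      using that by (rule matroid.indep_empty)
    moreover have "(2 / 3 - \<epsilon>) * real r \<le> 0" for r
      using True by (intro mult_nonpos_nonneg) auto
    ultimately show ?thesis using \<epsilon> rlog
      by (intro exI[of _ "\<lambda>V. Output {}"]) (auto simp: Let_def)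
  next
    case False
    let ?k = "nat \<lceil>1 / \<epsilon>\<rceil>"
    have "real ?k \<le> 1 / \<epsilon> + 1" using \<epsilon> of_int_ceiling_le_add_one[of "1 / \<epsilon>"] by simp
    moreover have "1 \<le> 1 / \<epsilon>" using False \<epsilon> by simp
    \<comment> \<open>Rounding up costs one extra round:
      \<open>2 + 7 * (1 / \<epsilon> + 1) = 9 + 7 / \<epsilon>\<close>, and
      \<open>9 \<le> 9 / \<epsilon>\<close> gives the constant 16.\<close>
    ultimately have "2 + 7 * real ?k \<le> 16 * (1 / \<epsilon>)" by linarith
    then have k: "2 + 7 * real ?k \<le> 16 / \<epsilon>" by simp
    have queries: "real (num_queries orc (matroid_intersection_alg ?k V))
        \<le> 16 * (real (card V) / \<epsilon> + real r * log 2 (real r))" if "finite V"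
      for orc r and V :: "'a set"
    proof -
      have "real (num_queries orc (matroid_intersection_alg ?k V))
          \<le> real ((2 + 7 * ?k) * card V)"
        using num_queries_matroid_intersection_alg[OF that] of_nat_le_iff by blast
      also have "\<dots> = (2 + 7 * real ?k) * real (card V)"
        by (simp only: of_nat_mult of_nat_add of_nat_numeral)
      also have "\<dots> \<le> 16 / \<epsilon> * real (card V)"
        by (intro mult_right_mono k) simp
      also have "\<dots> \<le> 16 * (real (card V) / \<epsilon> + real r * log 2 (real r))"
        using rlog[of r] by simp
      finally show ?thesis .
    qed
    show ?thesis
      unfolding Let_def
      by (intro exI[of _ "matroid_intersection_alg ?k"] allI impI conjI queries
          queries_within_matroid_intersection_alg matroid_intersection_alg_ratio[OF _ _ \<epsilon> refl])
        auto
  qed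
qed simp

end
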